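(* Let $S$ be a semigroup with exponent $n$. Then $$\omega(\Gamma(S))=\max\Big(\{r_a : m_a=1 \text{ and } a\in\mathcal{M}\}\cup\{\mu_k^a : m_a>1,\ 1\le k<m_a \text{ and } a\in\mathcal{M}\}\Big),$$ where $\mu_1^a=1+r_a$ and, for $k\ge 2$, $\mu_k^a=1+\nu(k)+\dfrac{r_a}{(r_a,k)}$, with $\nu(k)$ the number of terms (counted with multiplicity) in the prime factorization of $k$.
   Context: For a subset $X$ of a semigroup $S$, $\langle X\rangle$ denotes the subsemigroup generated by $X$; a semigroup is monogenic if it equals $\langle a\rangle=\{a^k : k\in\mathbb{N}\}$ for some element $a$, where $\mathbb{N}=\{1,2,\dots\}$. The cyclic graph $\Gamma(S)$ is the simple undirected graph with vertex set $S$ in which two distinct vertices $x,y$ are adjacent if and only if $\langle x,y\rangle$ is a monogenic subsemigroup of $S$. $\omega$ denotes the clique number. $S$ is of bounded exponent if there is a positive integer $n$ such that $x^n$ is idempotent for every $x\in S$; the least such $n$ is the exponent of $S$. For an element $a$ with $\langle a\rangle$ finite, its index $m_a$ is the least $m\in\mathbb{N}$ such that $a^m=a^y$ for some $y\in\mathbb{N}$, $y\ne m$, and its period $r_a$ is the least $r\in\mathbb{N}$ with $a^{m_a+r}=a^{m_a}$. A maximal monogenic subsemigroup of $S$ is a monogenic subsemigroup not properly contained in any other monogenic subsemigroup of $S$; $\mathcal{M}=\{a\in S : \langle a\rangle \text{ is a maximal monogenic subsemigroup of } S\}$. $(u,v)$ denotes the greatest common divisor. *)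

theory Defs
  imports "HOL-Library.Ramsey" "HOL-Library.Extended_Nat"
    "HOL-Computational_Algebra.Primes"
begin

(* The semigroup S is a type of class semigroup_mult, its carrier being UNIV.
   There is no unit, so the power operation of class power is not available. *)

(* Only exponents k \<ge> 1 are meaningful; exponent 0 yields the junk value a. *)
definition sg_power :: "'a::semigroup_mult \<Rightarrow> nat \<Rightarrow> 'a" where
  "sg_power a k = ((*) a ^^ (k - 1)) a"

inductive_set sg_gen :: "'a::semigroup_mult set \<Rightarrow> 'a set" for X where
  base: "x \<in> X \<Longrightarrow> x \<in> sg_gen X"
| mult: "x \<in> sg_gen X \<Longrightarrow> y \<in> sg_gen X \<Longrightarrow> x * y \<in> sg_gen X"

definition monogenic :: "'a::semigroup_mult set \<Rightarrow> bool" where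
  "monogenic T \<longleftrightarrow> (\<exists>a. T = sg_gen {a})"

lemma sg_power_1: "sg_power a 1 = a"
  by (simp add: sg_power_def)

lemma sg_power_Suc: "k \<ge> 1 \<Longrightarrow> sg_power a (Suc k) = a * sg_power a k"
  by (cases k) (auto simp: sg_power_def)

lemma sg_power_add:
  assumes "j \<ge> 1" "k \<ge> 1"
  shows "sg_power a (j + k) = sg_power a j * sg_power a k"
  using assms(1)
proof (induction j rule: dec_induct)
  case base
  show ?case using sg_power_Suc[OF assms(2)] by (simp add: sg_power_1[simplified])
next
  case (step j)
  then show ?case by (simp add: sg_power_Suc mult.assoc)
qed

lemma sg_gen_singleton: "sg_gen {a} = {sg_power a k | k. k \<ge> 1}"
proof (intro set_eqI iffI)
  fix x assume "x \<in> sg_gen {a}"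
  then show "x \<in> {sg_power a k | k. k \<ge> 1}"
  proof (induction rule: sg_gen.induct)
    case (base x)
    then show ?case using sg_power_1[of a] by force
  next
    case (mult x y)
    then obtain j k where "j \<ge> 1" "k \<ge> 1" "x = sg_power a j" "y = sg_power a k"
      by auto
    then have "x * y = sg_power a (j + k)" "j + k \<ge> 1"
      by (simp_all add: sg_power_add)
    then show ?case by blast
  qed
next
  fix x assume "x \<in> {sg_power a k | k. k \<ge> 1}"
  then obtain k where k: "k \<ge> 1" "x = sg_power a k" by blast
  from k(1) have "sg_power a k \<in> sg_gen {a}"
  proof (induction k rule: dec_induct)
    case base
    then show ?case by (simp add: sg_power_1[simplified] sg_gen.base)
  next
    case (step k)
    then show ?case by (simp add: sg_power_Suc sg_gen.base sg_gen.mult)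
  qed
  then show "x \<in> sg_gen {a}" using k(2) by simp
qed

definition cyclic_graph_edges :: "'a::semigroup_mult set set" where
  "cyclic_graph_edges = {{x, y} | x y. x \<noteq> y \<and> monogenic (sg_gen {x, y})}"

(* Supremum over the finite cliques, so that a graph having cliques of
   unbounded size (in particular, one with an infinite clique) gets \<infinity>. *)
definition clique_number :: "'v set \<Rightarrow> 'v set set \<Rightarrow> enat" where
  "clique_number V E = (SUP C \<in> {C. C \<subseteq> V \<and> finite C \<and> clique C E}. enat (card C))"

definition uniform_idempotent_power :: "'a::semigroup_mult itself \<Rightarrow> nat \<Rightarrow> bool" where
  "uniform_idempotent_power _ n \<longleftrightarrow>
     n \<ge> 1 \<and> (\<forall>x::'a. sg_power x n * sg_power x n = sg_power x n)"

definition bounded_exponent :: "'a::semigroup_mult itself \<Rightarrow> bool" where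
  "bounded_exponent S \<longleftrightarrow> (\<exists>n. uniform_idempotent_power S n)"

(* Meaningful only if S is of bounded exponent. *)
definition exponent :: "'a::semigroup_mult itself \<Rightarrow> nat" where
  "exponent S = (LEAST n. uniform_idempotent_power S n)"

(* Index and period are meaningful only if sg_gen {a} is finite. *)
definition sg_index :: "'a::semigroup_mult \<Rightarrow> nat" where
  "sg_index a = (LEAST m. m \<ge> 1 \<and> (\<exists>y\<ge>1. y \<noteq> m \<and> sg_power a m = sg_power a y))"

definition sg_period :: "'a::semigroup_mult \<Rightarrow> nat" where
  "sg_period a = (LEAST r. r \<ge> 1 \<and> sg_power a (sg_index a + r) = sg_power a (sg_index a))"

definition maximal_monogenic :: "'a::semigroup_mult set \<Rightarrow> bool" where
  "maximal_monogenic T \<longleftrightarrow> monogenic T \<and> \<not> (\<exists>U. monogenic U \<and> T \<subset> U)"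

definition max_generators :: "'a::semigroup_mult set" where
  "max_generators = {a. maximal_monogenic (sg_gen {a})}"

definition num_prime_factors :: "nat \<Rightarrow> nat" where
  "num_prime_factors k = size (prime_factorization k)"

definition mu :: "'a::semigroup_mult \<Rightarrow> nat \<Rightarrow> nat" where
  "mu a k = (if k = 1 then 1 + sg_period a
             else 1 + num_prime_factors k + sg_period a div gcd (sg_period a) k)"

end

theory Submission
  imports Defs "HOL-Number_Theory.Cong"
begin

text \<open>
  Suppose \<open>\<langle>x, y\<rangle> = \<langle>c\<rangle>\<close>. Then \<open>c\<close> is itself a word in \<open>x\<close> and \<open>y\<close>, so either
  \<open>c \<in> {x, y}\<close> or \<open>c\<close> is a product of two powers of \<open>c\<close>, that is, \<open>c\<close> has index 1 and generates
  a finite cyclic group. Hence an edge of the cyclic graph joins two elements of which one is a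
  power of the other, or two elements of one cyclic group (\<open>monogenic_edge_cases\<close>).

  A finite clique \<open>C\<close> therefore lies in a single monogenic subsemigroup
  (\<open>finite_clique_subset_monogenic\<close>). If some element of \<open>C\<close> has index greater than 1, such
  elements are totally ordered by the relation of being a power, and a greatest one has every other
  element of \<open>C\<close> among its powers. If all elements of \<open>C\<close> have index 1, they
  lie pairwise in cyclic groups, and the classical group-theoretic argument applies: for each prime
  \<open>p\<close> the \<open>p\<close>-parts of the elements of \<open>C\<close> are totally ordered, so one of them generates the
  others, and the product of these generators over all \<open>p\<close> generates a cyclic group containing \<open>C\<close>
  (\<open>pairwise_cyclic_imp_cyclic\<close>). As the sizes of the monogenic subsemigroups are bounded, one may
  take \<open>C \<subseteq> \<langle>a\<rangle>\<close> with \<open>\<langle>a\<rangle>\<close> maximal.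

  It remains to find the largest cliques inside \<open>\<langle>a\<rangle>\<close>, for \<open>a\<close> of index \<open>m\<close> and period \<open>r\<close>. The
  powers \<open>a\<^sup>d\<close> with \<open>d < m\<close> have index greater than 1 and are pairwise distinct, and two of them
  are adjacent exactly if one exponent divides the other. If \<open>k\<close> is the largest such exponent in the
  clique, these exponents form a chain of divisors of \<open>k\<close>, of which there are at most \<open>1 + \<nu>(k)\<close>.
  The remaining elements of the clique have index 1 and must be powers of \<open>a\<^sup>k\<close>; the elements of
  index 1 in \<open>\<langle>a\<^sup>k\<rangle>\<close> form a cyclic group with \<open>r / gcd(r, k)\<close> elements
  (\<open>card_kernel_power\<close>). The sum of the two bounds is \<open>\<mu>\<^sub>k\<close>. It is attained by a maximal
  chain of divisors of \<open>k\<close> together with that whole group. A clique without powers \<open>a\<^sup>d\<close>, \<open>d < m\<close>,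
  has at most \<open>r\<close> elements, which is attained if \<open>m = 1\<close> and is less than \<open>\<mu>\<^sub>1\<close> otherwise.
\<close>

section \<open>Powers and generated subsemigroups\<close>

lemma sg_power_mult:
  assumes "j \<ge> 1" "k \<ge> 1"
  shows "sg_power (sg_power a j) k = sg_power a (j * k)"
  using assms(2)
proof (induction k rule: dec_induct)
  case base
  show ?case by (simp add: sg_power_1[simplified])
next
  case (step k)
  have "sg_power (sg_power a j) (Suc k) = sg_power a j * sg_power a (j * k)"
    using step by (simp add: sg_power_Suc)
  also have "\<dots> = sg_power a (j + j * k)"
    using assms step by (intro sg_power_add[symmetric]) auto
  finally show ?case by simp
qed

lemma sg_power_commute:
  assumes "x * y = y * x" "k \<ge> 1"
  shows "x * sg_power y k = sg_power y k * x"
  using assms(2)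
proof (induction k rule: dec_induct)
  case base
  show ?case using assms by (simp add: sg_power_1[simplified])
next
  case (step k)
  then show ?case using assms by (simp add: sg_power_Suc) (metis mult.assoc)
qed

lemma sg_power_mult_distrib:
  assumes "x * y = y * x" "k \<ge> 1"
  shows "sg_power (x * y) k = sg_power x k * sg_power y k"
  using assms(2)
proof (induction k rule: dec_induct)
  case base
  show ?case by (simp add: sg_power_1[simplified])
next
  case (step k)
  have "y * sg_power x k = sg_power x k * y"
    using assms step by (intro sg_power_commute) auto
  then show ?case using step by (simp add: sg_power_Suc) (metis mult.assoc)
qed

lemma sg_power_idem:
  assumes "e * e = e" "k \<ge> 1"
  shows "sg_power e k = e"
  using assms(2)
  by (induction k rule: dec_induct) (simp_all add: sg_power_1[simplified] sg_power_Suc assms)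

lemma mem_sg_gen_singleton: "x \<in> sg_gen {a} \<longleftrightarrow> (\<exists>k\<ge>1. x = sg_power a k)"
  by (auto simp: sg_gen_singleton)

lemma sg_power_mem: "k \<ge> 1 \<Longrightarrow> sg_power a k \<in> sg_gen {a}"
  by (auto simp: sg_gen_singleton)

lemma self_mem_sg_gen: "a \<in> sg_gen {a}"
  by (simp add: sg_gen.base)

lemma sg_gen_least:
  assumes "X \<subseteq> sg_gen Y"
  shows "sg_gen X \<subseteq> sg_gen Y"
proof
  fix x assume "x \<in> sg_gen X"
  then show "x \<in> sg_gen Y" by induction (use assms in \<open>auto intro: sg_gen.mult\<close>)
qed

lemma sg_power_mem_sg_gen:
  assumes "x \<in> sg_gen X" "k \<ge> 1"
  shows "sg_power x k \<in> sg_gen X"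
  using sg_gen_least[of "{x}" X] sg_power_mem[OF assms(2)] assms by auto

lemma sg_gen_commute:
  assumes "\<And>x y. x \<in> X \<Longrightarrow> y \<in> X \<Longrightarrow> x * y = y * x" "u \<in> sg_gen X" "v \<in> sg_gen X"
  shows "u * v = v * u"
proof -
  have 1: "x * v = v * x" if "x \<in> X" for x
    using assms(3)
  proof induction
    case (base y)
    then show ?case using assms(1) that by blast
  next
    case (mult y z)
    then show ?case by (metis mult.assoc)
  qed
  show ?thesis using assms(2)
  proof induction
    case (base x)
    then show ?case by (rule 1)
  next
    case (mult y z)
    then show ?case by (metis mult.assoc)
  qed
qed

lemma monogenic_comparable:
  assumes "x \<in> sg_gen {y}"
  shows "monogenic (sg_gen {x, y})"
proof -
  have "sg_gen {x, y} = sg_gen {y}"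
    using assms by (intro equalityI sg_gen_least) (auto intro: sg_gen.base)
  then show ?thesis by (auto simp: monogenic_def)
qed

section \<open>Index and period\<close>

text \<open>
  Index and period are defined by two minimality conditions; the last claim turns them into a
  complete description of the equalities between powers, through which both are used afterwards.
  A coincidence of two powers exists at all because infinitely many exponents share finitely many
  values.
\<close>

lemma sg_index_period:
  assumes fin: "finite (sg_gen {a})"
  shows sg_index_ge_1: "sg_index a \<ge> 1"
    and sg_period_ge_1: "sg_period a \<ge> 1"
    and sg_power_eq_iff: "\<And>i j. i \<ge> 1 \<Longrightarrow> j \<ge> 1 \<Longrightarrow> sg_power a i = sg_power a j \<longleftrightarrow>
          i = j \<or> (sg_index a \<le> i \<and> sg_index a \<le> j \<and> [i = j] (mod sg_period a))"
proof -
  define m r where "m = sg_index a" and "r = sg_period a"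
  let ?P = "\<lambda>m. m \<ge> 1 \<and> (\<exists>y\<ge>1. y \<noteq> m \<and> sg_power a m = sg_power a y)"
  let ?Q = "\<lambda>r. r \<ge> 1 \<and> sg_power a (m + r) = sg_power a m"
  have "\<not> inj_on (sg_power a) {1..}"
    using finite_imageD[of "sg_power a" "{1..}"] finite_subset[OF _ fin, of "sg_power a ` {1..}"]
    by (auto simp: sg_gen_singleton infinite_Ici)
  then obtain i0 where "?P i0" by (auto simp: inj_on_def)
  then have P: "?P m" unfolding m_def sg_index_def by (rule LeastI)
  have m_le: "m \<le> i" if "?P i" for i
    unfolding m_def sg_index_def using that by (rule Least_le)
  from P obtain y where y: "y \<ge> 1" "y \<noteq> m" "sg_power a m = sg_power a y" by blast
  have "m \<le> y" using P y by (intro m_le) metis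
  with y have "?Q (y - m)" by simp
  then have Q: "?Q r" unfolding r_def sg_period_def m_def by (rule LeastI)
  have r_le: "r \<le> i" if "?Q i" for i
    using that unfolding r_def sg_period_def m_def by (rule Least_le)
  have shift1: "sg_power a (i + r) = sg_power a i" if "i \<ge> m" for i
  proof (cases "i = m")
    case False
    then have "sg_power a (i + r) = sg_power a ((i - m) + (m + r))" using that by simp
    also have "\<dots> = sg_power a (i - m) * sg_power a (m + r)"
      using False that P by (intro sg_power_add) auto
    also have "\<dots> = sg_power a (i - m) * sg_power a m" using Q by simp
    also have "\<dots> = sg_power a ((i - m) + m)"
      using False that P by (intro sg_power_add[symmetric]) auto
    finally show ?thesis using that by simp
  qed (use Q in auto)
  have shift: "sg_power a (i + q * r) = sg_power a i" if "i \<ge> m" for i q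
  proof (induction q)
    case (Suc q)
    have "sg_power a (i + Suc q * r) = sg_power a ((i + q * r) + r)" by (simp add: algebra_simps)
    also have "\<dots> = sg_power a (i + q * r)" using that by (intro shift1) simp
    finally show ?case using Suc by simp
  qed simp
  have cong_imp: "sg_power a i = sg_power a j"
    if "m \<le> i" "i \<le> j" "[i = j] (mod r)" for i j
  proof -
    from that obtain q where "j = i + q * r"
      by (metis cong_altdef_nat cong_sym dvd_def le_add_diff_inverse mult.commute)
    then show ?thesis using shift that by simp
  qed
  have imp_cong: "m \<le> i \<and> [i = j] (mod r)"
    if ij: "1 \<le> i" "i < j" "sg_power a i = sg_power a j" for i j
  proof -
    have mi: "m \<le> i" using ij by (intro m_le) (auto intro!: exI[of _ j])
    \<comment> \<open>Multiply by a power of \<open>a\<close> that moves the exponent \<open>i\<close> to one congruent to \<open>m\<close>.\<close>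
    define s where "s = m + i * (r - 1)"
    have s: "s \<ge> 1" using P by (simp add: s_def)
    have is_eq: "i + s = m + i * r"
      using Q by (cases r) (auto simp: s_def)
    have "sg_power a (i + s) = sg_power a i * sg_power a s"
      "sg_power a (j + s) = sg_power a j * sg_power a s"
      using ij s sg_power_add[of i s a] sg_power_add[of j s a] by auto
    then have "sg_power a (j + s) = sg_power a m" using ij is_eq shift[of m] by simp
    moreover have "j + s = (m + (j - i) mod r) + (i + (j - i) div r) * r"
    proof -
      have "j + s = (j - i) + (m + i * r)" using ij is_eq by simp
      also have "\<dots> = ((j - i) mod r + (j - i) div r * r) + (m + i * r)"
        by (subst mod_div_mult_eq) (rule refl)
      finally show ?thesis by (simp only: algebra_simps)
    qed
    ultimately have "sg_power a (m + (j - i) mod r) = sg_power a m" using shift by simp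
    moreover have "(j - i) mod r < r" using Q by simp
    ultimately have "(j - i) mod r = 0" using r_le[of "(j - i) mod r"] by (cases "(j - i) mod r") auto
    then have "[j = i] (mod r)" using ij by (simp add: cong_altdef_nat dvd_eq_mod_eq_0)
    then show ?thesis using mi by (simp add: cong_sym)
  qed
  show "sg_index a \<ge> 1" "sg_period a \<ge> 1" using P Q by (simp_all add: m_def r_def)
  show "sg_power a i = sg_power a j \<longleftrightarrow>
      i = j \<or> (sg_index a \<le> i \<and> sg_index a \<le> j \<and> [i = j] (mod sg_period a))"
    if "i \<ge> 1" "j \<ge> 1" for i j
    unfolding m_def[symmetric] r_def[symmetric]
  proof (cases i j rule: linorder_cases)
    case less
    then show "(sg_power a i = sg_power a j) = (i = j \<or> m \<le> i \<and> m \<le> j \<and> [i = j] (mod r))"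
      using that cong_imp[of i j] imp_cong[of i j] by auto
  next
    case greater
    then show "(sg_power a i = sg_power a j) = (i = j \<or> m \<le> i \<and> m \<le> j \<and> [i = j] (mod r))"
      using that cong_imp[of j i] imp_cong[of j i] cong_sym[of i j r] cong_sym[of j i r]
      by (metis le_trans less_imp_le)
  qed simp
qed

lemma sg_index_eq_1_iff:
  assumes "finite (sg_gen {a})"
  shows "sg_index a = 1 \<longleftrightarrow> (\<exists>j\<ge>2. sg_power a j = a)"
proof
  assume "sg_index a = 1"
  then have "sg_power a (1 + sg_period a) = sg_power a 1"
    using sg_period_ge_1[OF assms]
    by (subst sg_power_eq_iff[OF assms]) (auto simp: cong_altdef_nat)
  then show "\<exists>j\<ge>2. sg_power a j = a"
    using sg_period_ge_1[OF assms] by (intro exI[of _ "1 + sg_period a"]) (auto simp: sg_power_1[simplified])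
next
  assume "\<exists>j\<ge>2. sg_power a j = a"
  then obtain j where "j \<ge> 2" "sg_power a j = sg_power a 1" by (auto simp: sg_power_1[simplified])
  then show "sg_index a = 1"
    using sg_power_eq_iff[OF assms, of j 1] sg_index_ge_1[OF assms] by auto
qed

lemma finite_sg_gen_power:
  assumes "finite (sg_gen {a})" "x \<in> sg_gen {a}"
  shows "finite (sg_gen {x})"
  using assms sg_gen_least[of "{x}" "{a}"] finite_subset by blast

lemma sg_index_1_power_iff:
  assumes fin: "finite (sg_gen {a})" and k: "k \<ge> 1"
  shows "sg_index (sg_power a k) = 1 \<longleftrightarrow> sg_index a \<le> k"
proof -
  have "sg_index (sg_power a k) = 1 \<longleftrightarrow> (\<exists>j\<ge>2. sg_power a (k * j) = sg_power a k)"
    using sg_index_eq_1_iff[OF finite_sg_gen_power[OF fin sg_power_mem[OF k]]] k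
    by (auto simp: sg_power_mult)
  also have "\<dots> \<longleftrightarrow> sg_index a \<le> k"
  proof
    assume "\<exists>j\<ge>2. sg_power a (k * j) = sg_power a k"
    then obtain j where "j \<ge> 2" "sg_power a (k * j) = sg_power a k" by blast
    then show "sg_index a \<le> k"
      using k sg_power_eq_iff[OF fin, of "k * j" k] by auto
  next
    assume le: "sg_index a \<le> k"
    have "k \<le> k * (1 + sg_period a)" by simp
    then have "sg_power a (k * (1 + sg_period a)) = sg_power a k"
      using k le by (subst sg_power_eq_iff[OF fin]) (auto simp: cong_def)
    then show "\<exists>j\<ge>2. sg_power a (k * j) = sg_power a k"
      using sg_period_ge_1[OF fin] by (intro exI[of _ "1 + sg_period a"]) auto
  qed
  finally show ?thesis .
qed

lemma sg_index_1_mem: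
  assumes "finite (sg_gen {c})" "sg_index c = 1" "x \<in> sg_gen {c}"
  shows "sg_index x = 1"
  using assms sg_index_1_power_iff by (metis mem_sg_gen_singleton)

text \<open>
  From exponent \<open>m = sg_index a\<close> on, \<open>a\<^sup>i\<close> depends only on \<open>i\<close> modulo the period \<open>r\<close>. The elements of
  index 1 in the subsemigroup generated by \<open>a\<^sup>k\<close> are the \<open>a\<^bsup>kj\<^esup>\<close> with \<open>m \<le> kj\<close>, and \<open>kj\<close>
  modulo \<open>r\<close> is determined by, and determines, \<open>j\<close> modulo \<open>r / gcd(r, k)\<close>. A complete residue
  system of exponents \<open>j\<close> starting at \<open>m\<close> thus enumerates them without repetition.
\<close>

lemma card_kernel_power:
  assumes fin: "finite (sg_gen {a})" and k: "k \<ge> 1"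
  shows "card {x \<in> sg_gen {sg_power a k}. sg_index x = 1}
           = sg_period a div gcd (sg_period a) k"
proof -
  define m r where "m = sg_index a" and "r = sg_period a"
  define s where "s = r div gcd r k"
  have m: "m \<ge> 1" and r: "r \<ge> 1" using sg_index_ge_1[OF fin] sg_period_ge_1[OF fin]
    by (simp_all add: m_def r_def)
  have s: "s \<ge> 1" using r by (simp add: s_def Suc_leI div_greater_zero_iff gcd_le1_nat)
  have cong_iff: "[k * i = k * j] (mod r) \<longleftrightarrow> [i = j] (mod s)" for i j
  proof -
    define g where "g = gcd r k"
    have g: "g > 0" using r by (simp add: g_def)
    define k' where "k' = k div g"
    have k': "k = g * k'" by (simp add: k'_def g_def)
    have r': "r = g * s" by (simp add: s_def g_def)
    have "coprime (r div gcd r k) (k div gcd r k)" using r by (intro div_gcd_coprime) auto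
    then have "coprime k' s" by (simp add: s_def k'_def g_def coprime_commute)
    then have "[i = j] (mod s) \<longleftrightarrow> [k' * i = k' * j] (mod s)"
      by (simp add: cong_mult_lcancel_nat)
    also have "\<dots> \<longleftrightarrow> [k * i = k * j] (mod r)"
      using g by (simp add: k' r' cong_def mult.assoc mod_mult_mult1)
    finally show ?thesis by blast
  qed
  have le: "m \<le> k * j" if "m \<le> j" for j using that k
    by (metis le_trans mult_1 mult_le_mono1)
  have "{x \<in> sg_gen {sg_power a k}. sg_index x = 1} = (\<lambda>j. sg_power a (k * j)) ` {m..<m + s}"
  proof (intro equalityI subsetI)
    fix x assume "x \<in> {x \<in> sg_gen {sg_power a k}. sg_index x = 1}"
    then obtain j where j: "j \<ge> 1" "x = sg_power a (k * j)" "sg_index x = 1"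
      using k by (auto simp: mem_sg_gen_singleton sg_power_mult)
    then have mj: "m \<le> k * j" using sg_index_1_power_iff[OF fin, of "k * j"] k by (simp add: m_def)
    \<comment> \<open>The representative in \<open>{m..<m + s}\<close> of the residue class of \<open>j\<close>; the summand
      \<open>m * (s - 1)\<close> stands for \<open>- m\<close> modulo \<open>s\<close>.\<close>
    define j' where "j' = m + (j + m * (s - 1)) mod s"
    have "[j' = m + (j + m * (s - 1))] (mod s)" by (simp add: j'_def cong_def mod_add_right_eq)
    also have "m + (j + m * (s - 1)) = j + m * s" using s
      by (cases s) auto
    also have "[j + m * s = j] (mod s)" by (simp add: cong_def)
    finally have "[k * j' = k * j] (mod r)" by (simp add: cong_iff)
    then have "sg_power a (k * j') = x"
      using j(1,2) mj k le[of j'] m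
      by (simp, subst sg_power_eq_iff[OF fin]) (auto simp: m_def r_def j'_def)
    moreover have "j' \<in> {m..<m + s}" using s by (simp add: j'_def)
    ultimately show "x \<in> (\<lambda>j. sg_power a (k * j)) ` {m..<m + s}" by blast
  next
    fix x assume "x \<in> (\<lambda>j. sg_power a (k * j)) ` {m..<m + s}"
    then obtain j where j: "m \<le> j" "x = sg_power a (k * j)" by auto
    then have "x = sg_power (sg_power a k) j" using k m by (simp add: sg_power_mult)
    moreover have "sg_index x = 1"
      using sg_index_1_power_iff[OF fin le_trans[OF m le[OF j(1)]]] le[OF j(1)] j(2)
      by (simp add: m_def)
    ultimately show "x \<in> {x \<in> sg_gen {sg_power a k}. sg_index x = 1}"
      using j m by (auto intro: sg_power_mem)
  qed
  moreover have "inj_on (\<lambda>j. sg_power a (k * j)) {m..<m + s}"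
  proof (rule inj_onI)
    fix i j assume ij: "i \<in> {m..<m + s}" "j \<in> {m..<m + s}" "sg_power a (k * i) = sg_power a (k * j)"
    then have "[k * i = k * j] (mod r)"
      using sg_power_eq_iff[OF fin, of "k * i" "k * j"] k m by (auto simp: r_def)
    then have c: "[i = j] (mod s)" by (simp add: cong_iff)
    show "i = j"
    proof (cases "i \<le> j")
      case True
      then have "s dvd j - i" using c by (metis cong_altdef_nat cong_sym)
      then show ?thesis using ij True by (auto dest!: dvd_imp_le)
    next
      case False
      then have "s dvd i - j" using c by (metis cong_altdef_nat nat_le_linear)
      then show ?thesis using ij False by (auto dest!: dvd_imp_le)
    qed
  qed
  ultimately show ?thesis by (simp add: card_image s_def r_def)
qed

section \<open>Edges of the cyclic graph and bounded exponent\<close>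

text \<open>
  Being a power of another element is transitive, so a finite nonempty set on which it is total has a
  greatest element.
\<close>

lemma exists_greatest_sg_gen:
  assumes "finite C" "C \<noteq> {}"
    and comp: "\<And>x y. x \<in> C \<Longrightarrow> y \<in> C \<Longrightarrow> x \<in> sg_gen {y} \<or> y \<in> sg_gen {x}"
  shows "\<exists>t\<in>C. C \<subseteq> sg_gen {t}"
  using assms
proof (induction rule: finite_ne_induct)
  case (singleton x)
  then show ?case by (simp add: self_mem_sg_gen)
next
  case (insert x F)
  then obtain t where t: "t \<in> F" "F \<subseteq> sg_gen {t}" by blast
  consider "x \<in> sg_gen {t}" | "t \<in> sg_gen {x}" using insert.prems[of x t] t by blast
  then show ?case
  proof cases
    case 1
    then show ?thesis using t by blast
  next
    case 2
    then have "sg_gen {t} \<subseteq> sg_gen {x}" by (intro sg_gen_least) auto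
    then show ?thesis using t self_mem_sg_gen[of x] by blast
  qed
qed

text \<open>
  If \<open>{x, y}\<close> generates the same subsemigroup as \<open>c\<close>, then \<open>c\<close> is a generator \<open>x\<close> or \<open>y\<close>, or a
  product of two elements that are powers of \<open>c\<close>. The second possibility gives \<open>c = c\<^bsup>s + t\<^esup>\<close> with
  \<open>s + t \<ge> 2\<close>, so that \<open>c\<close> has index 1.
\<close>

lemma monogenic_edge_cases:
  assumes fin: "\<And>a :: 'a::semigroup_mult. finite (sg_gen {a})"
    and mono: "monogenic (sg_gen {x, y :: 'a})"
  obtains "x \<in> sg_gen {y}" | "y \<in> sg_gen {x}"
    | c where "sg_index c = 1" "x \<in> sg_gen {c}" "y \<in> sg_gen {c}"
proof -
  from mono obtain c where c: "sg_gen {x, y} = sg_gen {c}" by (auto simp: monogenic_def)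
  then have xy: "x \<in> sg_gen {c}" "y \<in> sg_gen {c}" using sg_gen.base[of _ "{x, y}"] by auto
  have "c \<in> sg_gen {x, y}" using c self_mem_sg_gen by simp
  then consider "c \<in> {x, y}" | u v where "c = u * v" "u \<in> sg_gen {x, y}" "v \<in> sg_gen {x, y}"
    by cases auto
  then show ?thesis
  proof cases
    case 1
    then show ?thesis using xy that by auto
  next
    case 2
    from 2(2,3) obtain s t where st: "s \<ge> 1" "t \<ge> 1" "u = sg_power c s" "v = sg_power c t"
      unfolding c mem_sg_gen_singleton by blast
    then have "sg_power c (s + t) = c" using 2(1) by (metis sg_power_add)
    then have "sg_index c = 1" using st by (subst sg_index_eq_1_iff[OF fin]) (auto intro!: exI[of _ "s + t"])
    then show ?thesis using xy that by auto
  qed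
qed

text \<open>
  Subsemigroups of a finite cyclic group are cyclic groups: \<open>c\<^sup>i\<close> and \<open>c\<^sup>j\<close> generate the same
  subsemigroup as \<open>c\<close> raised to \<open>gcd i j\<close>, by Bezout's identity.
\<close>

lemma monogenic_of_cyclic:
  assumes fin: "finite (sg_gen {c})" and c: "sg_index c = 1"
    and x: "x \<in> sg_gen {c}" and y: "y \<in> sg_gen {c}"
  shows "monogenic (sg_gen {x, y})"
proof -
  obtain i j where ij: "i \<ge> 1" "x = sg_power c i" "j \<ge> 1" "y = sg_power c j"
    using x y by (auto simp: mem_sg_gen_singleton)
  define r where "r = sg_period c"
  have r: "r \<ge> 1" using sg_period_ge_1[OF fin] by (simp add: r_def)
  have eq: "sg_power c u = sg_power c v" if "u \<ge> 1" "v \<ge> 1" "[u = v] (mod r)" for u v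
    using that by (subst sg_power_eq_iff[OF fin]) (auto simp: c r_def)
  define g where "g = gcd i j"
  have g: "g \<ge> 1" using ij by (simp add: g_def Suc_leI)
  obtain u v where uv: "i * u = j * v + g" using bezout_nat[of i j] ij unfolding g_def by auto
  \<comment> \<open>Bezout's identity with both coefficients positive, modulo the period.\<close>
  define u' v' where "u' = u + r" and "v' = v * (r - 1) + r"
  have "[i * u' + j * v' = g] (mod r)"
  proof -
    have "v' + v = (v + 1) * r" using r by (cases r) (auto simp: v'_def)
    then have "j * v' + j * v = j * ((v + 1) * r)" by (metis distrib_left)
    then have "i * u' + j * v' = g + r * (i + j * (v + 1))" using uv
      by (simp add: u'_def algebra_simps)
    then show ?thesis by (simp add: cong_def)
  qed
  then have "sg_power c g = sg_power c (i * u' + j * v')"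
    using ij g r by (intro eq) (auto simp: u'_def cong_sym Suc_leI)
  also have "\<dots> = sg_power x u' * sg_power y v'"
    using ij r by (simp add: u'_def v'_def sg_power_add sg_power_mult)
  also have "\<dots> \<in> sg_gen {x, y}"
    using r by (intro sg_gen.mult sg_power_mem_sg_gen sg_gen.base) (auto simp: u'_def v'_def)
  finally have gin: "sg_power c g \<in> sg_gen {x, y}" .
  have "sg_power c l \<in> sg_gen {sg_power c g}" if "g dvd l" "l \<ge> 1" for l
  proof -
    from that obtain q where "l = g * q" "q \<ge> 1" by (auto elim!: dvdE intro: Suc_leI)
    then show ?thesis using g by (auto simp: mem_sg_gen_singleton sg_power_mult)
  qed
  then have "{x, y} \<subseteq> sg_gen {sg_power c g}" using ij by (auto simp: g_def)
  then have "sg_gen {x, y} = sg_gen {sg_power c g}"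
    using gin by (intro equalityI sg_gen_least) auto
  then show ?thesis by (auto simp: monogenic_def)
qed

text \<open>
  Everything follows from \<open>a\<^bsup>2n\<^esup> = a\<^sup>n\<close>. In particular the sizes of the monogenic subsemigroups are
  uniformly bounded.
\<close>

lemma uniform_idempotent_power_props:
  assumes "uniform_idempotent_power TYPE('a::semigroup_mult) n"
  shows finite_sg_gen: "finite (sg_gen {a :: 'a})"
    and sg_index_le: "sg_index a \<le> n"
    and sg_period_dvd: "sg_period a dvd n"
    and card_sg_gen_le: "card (sg_gen {a}) \<le> 2 * n"
proof -
  have n: "n \<ge> 1" and "sg_power a n * sg_power a n = sg_power a n"
    using assms by (auto simp: uniform_idempotent_power_def)
  then have e: "sg_power a (n + n) = sg_power a n" by (simp add: sg_power_add)
  have low: "sg_power a k \<in> sg_power a ` {1..2 * n}" if "k \<ge> 1" for k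
    using that
  proof (induction k rule: less_induct)
    case (less k)
    show ?case
    proof (cases "k \<le> 2 * n")
      case False
      have "sg_power a k = sg_power a ((n + n) + (k - 2 * n))" using False by simp
      also have "\<dots> = sg_power a n * sg_power a (k - 2 * n)"
        using False n sg_power_add[of "n + n" "k - 2 * n" a] by (simp add: e)
      also have "\<dots> = sg_power a (k - n)"
        using False n sg_power_add[of n "k - 2 * n" a] by simp
      finally show ?thesis using less.IH[of "k - n"] False n by simp
    qed (use less in auto)
  qed
  then have sub: "sg_gen {a} \<subseteq> sg_power a ` {1..2 * n}" by (auto simp: mem_sg_gen_singleton)
  show fin: "finite (sg_gen {a})" using sub by (rule finite_subset) simp
  show "card (sg_gen {a}) \<le> 2 * n"
    using card_mono[OF _ sub] card_image_le[of "{1..2 * n}" "sg_power a"] by simp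
  have "sg_index a \<le> n \<and> [n + n = n] (mod sg_period a)"
    using e n by (subst (asm) sg_power_eq_iff[OF fin]) auto
  then show "sg_index a \<le> n" "sg_period a dvd n" by (auto simp: cong_altdef_nat)
qed

section \<open>Pairwise cyclic elements lie in one cyclic group\<close>

lemma left_unit_sg_power:
  assumes "e * x = x" "k \<ge> 1"
  shows "e * sg_power x k = sg_power x k"
  using assms(2)
  by (induction k rule: dec_induct)
    (simp_all add: assms sg_power_1[simplified] sg_power_Suc flip: mult.assoc)

text \<open>
  If \<open>x\<close> belongs to a group with identity \<open>e\<close> and its order divides \<open>q\<close>, exponents matter only modulo
  \<open>q\<close>. Here \<open>q\<close> need not be the period of \<open>x\<close>.
\<close>

lemma power_cong_of_unit:
  assumes "sg_power x q = e" "e * x = x" "e * e = e" "q \<ge> 1"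
    "u \<ge> 1" "v \<ge> 1" "[u = v] (mod q)"
  shows "sg_power x u = sg_power x v"
proof -
  have step: "sg_power x (w + k * q) = sg_power x w" if "w \<ge> 1" for w k
  proof (induction k)
    case (Suc k)
    have "e * sg_power x (w + k * q) = sg_power x (w + k * q)"
      using that assms by (simp add: left_unit_sg_power)
    moreover have "sg_power x (q + (w + k * q)) = sg_power x q * sg_power x (w + k * q)"
      using assms that by (intro sg_power_add) auto
    ultimately show ?case using Suc assms by (simp add: algebra_simps)
  qed simp
  have *: "sg_power x u = sg_power x v" if "u \<le> v" "u \<ge> 1" "[u = v] (mod q)" for u v
  proof -
    have "q dvd v - u" using that by (metis cong_altdef_nat cong_sym)
    then obtain k where "v - u = q * k" by (rule dvdE)
    then have "v = u + k * q" using that(1) by (simp add: mult.commute)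
    then show ?thesis using step that by simp
  qed
  show ?thesis
    using *[OF _ assms(5,7)] *[OF _ assms(6) cong_sym[OF assms(7)], symmetric] nat_le_linear by blast
qed

text \<open>
  Both elements lie in the \<open>p\<close>-part of a cyclic group, whose subgroups form a chain.
\<close>

lemma prime_power_order_comparable:
  assumes fin: "finite (sg_gen {c})" and c: "sg_index c = 1"
    and p: "prime p" and x: "x \<in> sg_gen {c}" and y: "y \<in> sg_gen {c}"
    and xe: "sg_power x (p ^ k) = e" and ye: "sg_power y (p ^ k) = e" and e: "e * e = e"
  shows "x \<in> sg_gen {y} \<or> y \<in> sg_gen {x}"
proof -
  obtain i j where i: "i \<ge> 1" "x = sg_power c i" and j: "j \<ge> 1" "y = sg_power c j"
    using x y by (auto simp: mem_sg_gen_singleton)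
  define r where "r = sg_period c"
  define q where "q = p ^ k"
  have q: "q \<ge> 1" using p by (simp add: q_def Suc_leI prime_gt_0_nat)
  have r: "r dvd l * q" if "l \<ge> 1" "sg_power c (l * q) = e" for l
  proof -
    have "sg_power c (l * q + l * q) = sg_power c (l * q)"
      using that q e by (simp add: sg_power_add)
    then have "[l * q + l * q = l * q] (mod r)"
      using that q by (subst (asm) sg_power_eq_iff[OF fin]) (auto simp: r_def Suc_leI)
    then show ?thesis by (simp add: cong_altdef_nat)
  qed
  have "r dvd i * q" "r dvd j * q"
    using r[OF i(1)] r[OF j(1)] i j xe ye q by (simp_all add: sg_power_mult flip: q_def)
  then have rg: "r dvd gcd i j * q" by (metis gcd_greatest gcd_mult_distrib_nat mult.commute)
  define g where "g = gcd i j"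
  have g: "g \<ge> 1" using i by (simp add: g_def Suc_leI)
  \<comment> \<open>The cofactor of \<open>g\<close> in one of the two exponents is prime to \<open>p\<close>, so that the
    corresponding element generates \<open>c\<^sup>g\<close>.\<close>
  have gen: "sg_power c l \<in> sg_gen {sg_power c h}"
    if h: "h = g * h'" "\<not> p dvd h'" "h \<ge> 1" and l: "g dvd l" "l \<ge> 1" for h h' l
  proof -
    have "coprime h' q" using prime_imp_coprime[OF p h(2)]
      by (simp add: q_def coprime_commute)
    then obtain s where s: "[h' * s = 1] (mod q)" using cong_solve_coprime_nat by auto
    from l obtain l' where l': "l = g * l'" by blast
    have "[h' * (s + q) = 1] (mod q)" using s by (simp add: cong_def algebra_simps)
    then have "[g * (h' * (s + q)) = g * 1] (mod (g * q))" by (simp add: cong_def mod_mult_mult1)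
    then have "[g * (h' * (s + q)) = g * 1] (mod r)" using rg by (metis cong_dvd_modulus_nat g_def)
    then have "[g * (h' * (s + q)) * l' = g * 1 * l'] (mod r)" by (rule cong_scalar_right)
    then have "[h * ((s + q) * l') = l] (mod r)" using h l' by (simp add: mult.assoc)
    moreover have "(s + q) * l' \<ge> 1" using q l l' by (simp add: Suc_leI)
    ultimately have "sg_power c (h * ((s + q) * l')) = sg_power c l"
      using h l by (subst sg_power_eq_iff[OF fin]) (auto simp: c r_def Suc_leI)
    then have "sg_power c l = sg_power (sg_power c h) ((s + q) * l')"
      using h \<open>(s + q) * l' \<ge> 1\<close> by (simp add: sg_power_mult)
    then show ?thesis using \<open>(s + q) * l' \<ge> 1\<close> by (metis sg_power_mem)
  qed
  define i' j' where "i' = i div g" and "j' = j div g"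
  have ij': "i = g * i'" "j = g * j'" by (simp_all add: i'_def j'_def g_def)
  have "coprime i' j'" unfolding i'_def j'_def g_def using i by (intro div_gcd_coprime) auto
  then have "\<not> p dvd i' \<or> \<not> p dvd j'" using p by (meson coprime_common_divisor not_prime_unit)
  then show ?thesis using gen[OF ij'(1) _ i(1), of j] gen[OF ij'(2) _ j(1), of i] i j
    by (auto simp: g_def)
qed

text \<open>
  Induction on the common exponent \<open>N = q m\<close>, where \<open>q\<close> is the full power of a prime \<open>p\<close> dividing
  \<open>N\<close>. The powers \<open>x\<^sup>m\<close> with \<open>x \<in> C\<close> have orders dividing \<open>q\<close>, so they are powers of one of them, \<open>t\<close>. The
  powers \<open>x\<^sup>q\<close> have orders dividing \<open>m\<close>, so by induction they are powers of one element \<open>h\<close>. Since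
  \<open>q\<close> and \<open>m\<close> are coprime and \<open>t\<close> and \<open>h\<close> commute, the powers of \<open>t h\<close> are all products of a
  power of \<open>t\<close> and a power of \<open>h\<close>, and every \<open>x\<close> is such a product. The witness is kept inside
  \<open>sg_gen C\<close> to make \<open>t\<close> and \<open>h\<close> commute.
\<close>

lemma pairwise_cyclic_imp_cyclic:
  fixes C :: "'a::semigroup_mult set"
  assumes fin: "\<And>a :: 'a. finite (sg_gen {a})" and e: "e * e = e"
    and "finite C" "C \<noteq> {}" "N \<ge> 1"
    and "\<And>x. x \<in> C \<Longrightarrow> sg_power x N = e \<and> e * x = x"
    and "\<And>x y. x \<in> C \<Longrightarrow> y \<in> C \<Longrightarrow> \<exists>c. sg_index c = 1 \<and> x \<in> sg_gen {c} \<and> y \<in> sg_gen {c}"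
  shows "\<exists>h\<in>sg_gen C. C \<subseteq> sg_gen {h} \<and> sg_power h N = e \<and> e * h = h"
  using assms(3-)
proof (induction N arbitrary: C rule: less_induct)
  case (less N)
  note C = less.prems
  show ?case
  proof (cases "N = 1")
    case True
    then have "C = {e}" using C by (auto simp: sg_power_1[simplified])
    then show ?thesis using e by (auto simp: self_mem_sg_gen True sg_power_1[simplified])
  next
    case False
    then obtain p where p: "prime p" "p dvd N" using prime_factor_nat by blast
    define k where "k = multiplicity p N"
    define q where "q = p ^ k"
    obtain m where m: "N = q * m" "\<not> p dvd m"
      using multiplicity_decompose'[of N p] C p unfolding q_def k_def
      by (metis not_prime_unit not_one_le_zero)
    have "k > 0" using p C by (simp add: k_def prime_multiplicity_gt_zero_iff)
    then have q1: "q > 1" using p by (metis q_def one_less_power prime_gt_1_nat)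
    have m1: "m \<ge> 1" using C m by (cases m) auto
    have mN: "m < N" using m q1 m1 by simp
    have cop: "coprime q m" using p m by (simp add: q_def prime_imp_coprime)
    have pw: "sg_power x i \<in> sg_gen {c}" if "x \<in> sg_gen {c}" "i \<ge> 1" for x c :: 'a and i
      using that by (rule sg_power_mem_sg_gen)
    have unit: "e * sg_power x i = sg_power x i" if "x \<in> C" "i \<ge> 1" for x i
      using C(4)[OF that(1)] that(2) by (simp add: left_unit_sg_power)
    \<comment> \<open>The \<open>p\<close>-parts of the elements are totally ordered.\<close>
    have "\<exists>t\<in>(\<lambda>x. sg_power x m) ` C. (\<lambda>x. sg_power x m) ` C \<subseteq> sg_gen {t}"
    proof (rule exists_greatest_sg_gen)
      fix x y assume "x \<in> (\<lambda>x. sg_power x m) ` C" "y \<in> (\<lambda>x. sg_power x m) ` C"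
      then obtain x' y' where xy: "x' \<in> C" "y' \<in> C" "x = sg_power x' m" "y = sg_power y' m" by auto
      then obtain c where c: "sg_index c = 1" "x' \<in> sg_gen {c}" "y' \<in> sg_gen {c}"
        using C(5) by blast
      have "sg_power x (p ^ k) = e" "sg_power y (p ^ k) = e"
        using xy C(4) m1 q1 m by (auto simp: sg_power_mult mult.commute simp flip: q_def)
      then show "x \<in> sg_gen {y} \<or> y \<in> sg_gen {x}"
        using prime_power_order_comparable[OF fin c(1) p(1) pw[OF c(2) m1] pw[OF c(3) m1], of k e]
          xy e by simp
    qed (use C in auto)
    then obtain x0 where x0: "x0 \<in> C" and top: "\<And>x. x \<in> C \<Longrightarrow> sg_power x m \<in> sg_gen {sg_power x0 m}"
      by auto
    define t where "t = sg_power x0 m"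
    have "\<exists>h\<in>sg_gen ((\<lambda>x. sg_power x q) ` C).
      (\<lambda>x. sg_power x q) ` C \<subseteq> sg_gen {h} \<and> sg_power h m = e \<and> e * h = h"
    proof (rule less.IH[OF mN])
      fix x assume "x \<in> (\<lambda>x. sg_power x q) ` C"
      then show "sg_power x m = e \<and> e * x = x" using C(4) m1 q1 m unit by (auto simp: sg_power_mult)
    next
      fix x y assume "x \<in> (\<lambda>x. sg_power x q) ` C" "y \<in> (\<lambda>x. sg_power x q) ` C"
      then obtain x' y' where xy: "x' \<in> C" "y' \<in> C" "x = sg_power x' q" "y = sg_power y' q" by auto
      then obtain c where c: "sg_index c = 1" "x' \<in> sg_gen {c}" "y' \<in> sg_gen {c}"
        using C(5) by blast
      then show "\<exists>c. sg_index c = 1 \<and> x \<in> sg_gen {c} \<and> y \<in> sg_gen {c}"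
        using xy pw q1 by (intro exI[of _ c]) auto
    qed (use C m1 in auto)
    then obtain h where h: "h \<in> sg_gen ((\<lambda>x. sg_power x q) ` C)" "sg_power h m = e" "e * h = h"
      and hC: "\<And>x. x \<in> C \<Longrightarrow> sg_power x q \<in> sg_gen {h}" by auto
    have tC: "t \<in> sg_gen C" using x0 m1 unfolding t_def
      by (intro sg_power_mem_sg_gen sg_gen.base)
    have "(\<lambda>x. sg_power x q) ` C \<subseteq> sg_gen C"
      using q1 by (intro image_subsetI sg_power_mem_sg_gen sg_gen.base) auto
    then have hinC: "h \<in> sg_gen C" using h(1) sg_gen_least by blast
    have "x * y = y * x" if xy: "x \<in> C" "y \<in> C" for x y
    proof -
      obtain c where "x \<in> sg_gen {c}" "y \<in> sg_gen {c}" using C(5)[OF xy] by blast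
      then show ?thesis using sg_gen_commute[of "{c}" x y] by simp
    qed
    then have th: "t * h = h * t" using sg_gen_commute[OF _ tC hinC] by blast
    have tq: "sg_power t q = e" using x0 C(4) m m1 q1
      by (simp add: t_def sg_power_mult mult.commute)
    have et: "e * t = t" using unit[OF x0 m1] by (simp add: t_def)
    have "sg_power (t * h) N = sg_power t N * sg_power h N"
      using th C(3) by (rule sg_power_mult_distrib)
    also have "sg_power t N = sg_power (sg_power t q) m" using m m1 q1 by (simp add: sg_power_mult)
    also have "sg_power h N = sg_power (sg_power h m) q"
      using m m1 q1 by (simp add: sg_power_mult mult.commute)
    finally have thN: "sg_power (t * h) N = e" using h tq m1 q1 by (simp add: sg_power_idem e)
    have "x \<in> sg_gen {t * h}" if x: "x \<in> C" for x
    proof -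
      obtain \<alpha> where \<alpha>: "\<alpha> \<ge> 1" "sg_power x m = sg_power t \<alpha>"
        using top[OF x] by (auto simp: mem_sg_gen_singleton t_def)
      obtain \<beta> where \<beta>: "\<beta> \<ge> 1" "sg_power x q = sg_power h \<beta>"
        using hC[OF x] by (auto simp: mem_sg_gen_singleton)
      obtain u where u: "[m * u = 1] (mod q)"
        using cop cong_solve_coprime_nat[of m q] by (auto simp: coprime_commute)
      obtain v where v: "[q * v = 1] (mod m)"
        using cop cong_solve_coprime_nat[of q m] by auto
      \<comment> \<open>Adding the moduli makes the coefficients positive, as exponents have to be.\<close>
      define u' v' where "u' = u + q" and "v' = v + m"
      have u1: "u' \<ge> 1" and v1: "v' \<ge> 1" using q1 m1 by (auto simp: u'_def v'_def)
      have mu: "m * u' \<ge> 1" and qv: "q * v' \<ge> 1" using m1 q1 u1 v1 by (simp_all add: Suc_leI)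
      have "[m * u' + q * v' = 1] (mod q)" "[m * u' + q * v' = 1] (mod m)"
        using u v by (auto simp: u'_def v'_def cong_def algebra_simps)
      then have "[m * u' + q * v' = 1] (mod N)"
        unfolding m by (intro coprime_cong_mult_nat cop)
      then have "sg_power x (m * u' + q * v') = sg_power x 1"
        using C(3) C(4)[OF x] trans_le_add1[OF mu] e
        by (intro power_cong_of_unit[of x N e]) (blast | simp)+
      then have "x = sg_power x (m * u') * sg_power x (q * v')"
        using sg_power_add[OF mu qv, of x] by (simp add: sg_power_1[simplified])
      also have "\<dots> = sg_power t (\<alpha> * u') * sg_power h (\<beta> * v')"
        using sg_power_mult[of m u' x] sg_power_mult[of \<alpha> u' t] sg_power_mult[of q v' x]
          sg_power_mult[of \<beta> v' h] \<alpha> \<beta> m1 q1 u1 v1 by simp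
      finally have xeq: "x = sg_power t (\<alpha> * u') * sg_power h (\<beta> * v')" .
      obtain w0 where w0: "[w0 = \<alpha> * u'] (mod q)" "[w0 = \<beta> * v'] (mod m)"
        using binary_chinese_remainder_nat[OF cop] by blast
      define w where "w = w0 + N"
      have w: "[w = \<alpha> * u'] (mod q)" "[w = \<beta> * v'] (mod m)"
        using w0 by (auto simp: w_def m cong_def)
      have w1: "w \<ge> 1" using C(3) by (simp add: w_def)
      have au: "\<alpha> * u' \<ge> 1" and bv: "\<beta> * v' \<ge> 1" and "q \<ge> 1"
        using \<alpha> \<beta> q1 u1 v1 by (simp_all add: Suc_leI)
      have "sg_power (t * h) w = sg_power t w * sg_power h w"
        using th w1 by (rule sg_power_mult_distrib)
      also have "sg_power t w = sg_power t (\<alpha> * u')"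
        using \<open>q \<ge> 1\<close> w1 au w(1) by (rule power_cong_of_unit[OF tq et e])
      also have "sg_power h w = sg_power h (\<beta> * v')"
        using m1 w1 bv w(2) by (rule power_cong_of_unit[OF h(2,3) e])
      finally have "sg_power (t * h) w = x" using xeq by simp
      then show ?thesis using sg_power_mem[OF w1] by metis
    qed
    moreover have "e * (t * h) = t * h" by (simp add: et flip: mult.assoc)
    ultimately show ?thesis using thN sg_gen.mult[OF tC hinC] by blast
  qed
qed

section \<open>Chains of divisors\<close>

lemma num_prime_factors_less:
  assumes "d dvd k" "d \<noteq> k" "k \<ge> 1"
  shows "num_prime_factors d < num_prime_factors k"
proof -
  have "d \<noteq> 0" "k \<noteq> 0" using assms by auto
  then have "prime_factorization d \<subseteq># prime_factorization k"
    using assms by (simp add: prime_factorization_subset_iff_dvd)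
  moreover have "prime_factorization d \<noteq> prime_factorization k"
    using \<open>d \<noteq> 0\<close> \<open>k \<noteq> 0\<close> assms(2) by (metis prod_mset_prime_factorization_nat neq0_conv)
  ultimately show ?thesis
    unfolding num_prime_factors_def by (intro mset_subset_size) (simp add: subset_mset.less_le)
qed

text \<open>
  Along a chain of divisors \<open>num_prime_factors\<close> is strictly increasing, and it takes values in
  \<open>{0..num_prime_factors k}\<close>.
\<close>

lemma card_divisor_chain_le:
  assumes k: "k \<ge> 1" and D: "\<And>d. d \<in> D \<Longrightarrow> d dvd k"
    and chain: "\<And>c d. c \<in> D \<Longrightarrow> d \<in> D \<Longrightarrow> c dvd d \<or> d dvd c"
  shows "card D \<le> 1 + num_prime_factors k"
proof -
  have "inj_on num_prime_factors D"
  proof (rule inj_onI)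
    fix c d assume cd: "c \<in> D" "d \<in> D" "num_prime_factors c = num_prime_factors d"
    have "c \<ge> 1" "d \<ge> 1" using D[OF cd(1)] D[OF cd(2)] k by (auto simp: Suc_le_eq dest: dvd_pos_nat)
    then show "c = d"
      using chain[OF cd(1,2)] num_prime_factors_less[of c d] num_prime_factors_less[of d c] cd(3) by auto
  qed
  moreover have "num_prime_factors ` D \<subseteq> {..num_prime_factors k}"
    using D num_prime_factors_less[OF _ _ k] by (metis atMost_iff image_subsetI less_imp_le order_refl)
  ultimately have "card D \<le> card {..num_prime_factors k}" by (intro card_inj_on_le) auto
  then show ?thesis by simp
qed

text \<open>
  The bound of \<open>card_divisor_chain_le\<close> is attained: remove one prime factor of \<open>k\<close> at a time.
\<close>

lemma exists_divisor_chain: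
  assumes "k \<ge> (1::nat)"
  shows "\<exists>D. finite D \<and> card D = 1 + num_prime_factors k \<and> (\<forall>d\<in>D. d dvd k) \<and>
    (\<forall>c\<in>D. \<forall>d\<in>D. c dvd d \<or> d dvd c)"
  using assms
proof (induction k rule: less_induct)
  case (less k)
  show ?case
  proof (cases "k = 1")
    case True
    then show ?thesis by (intro exI[of _ "{1}"]) (auto simp: num_prime_factors_def)
  next
    case False
    then obtain p where p: "prime p" "p dvd k" using prime_factor_nat by blast
    then obtain k' where k': "k = p * k'" by blast
    have k'1: "k' \<ge> 1" using less.prems k' by (cases k') auto
    have lt: "k' < k" using k' k'1 prime_gt_1_nat[OF p(1)] by simp
    have npf: "num_prime_factors k = 1 + num_prime_factors k'"
      using p k' k'1 by (simp add: num_prime_factors_def prime_factorization_mult prime_factorization_prime)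
    obtain D where D: "finite D" "card D = 1 + num_prime_factors k'" "\<forall>d\<in>D. d dvd k'"
      "\<forall>c\<in>D. \<forall>d\<in>D. c dvd d \<or> d dvd c" using less.IH[OF lt k'1] by blast
    have "k \<notin> D" using D(3) lt k'1 by (metis dvd_imp_le leD less_le_trans zero_less_one)
    moreover have "\<forall>d\<in>D. d dvd k" using D(3) k' by (metis dvd_mult)
    ultimately show ?thesis using D npf by (intro exI[of _ "insert k D"]) auto
  qed
qed

text \<open>
  The case distinction in \<open>mu\<close> disappears because 1 has no prime factors and \<open>gcd r 1 = 1\<close>.
\<close>

lemma mu_eq:
  "mu a k = 1 + num_prime_factors k + sg_period a div gcd (sg_period a) k"
  by (simp add: mu_def num_prime_factors_def)

section \<open>Cliques\<close>

lemma clique_cyclic_graph_iff: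
  "clique C cyclic_graph_edges \<longleftrightarrow> (\<forall>x\<in>C. \<forall>y\<in>C. monogenic (sg_gen {x, y}))"
proof -
  have "{x, y} \<in> cyclic_graph_edges \<longleftrightarrow> monogenic (sg_gen {x, y})" if "x \<noteq> y" for x y :: 'a
    using that by (auto simp: cyclic_graph_edges_def)
  moreover have "monogenic (sg_gen {x, x})" for x :: 'a by (auto simp: monogenic_def)
  ultimately show ?thesis unfolding clique_def by metis
qed

text \<open>
  If all elements of the clique have index 1, the uniform exponent provides the common identity
  \<open>x\<^sup>n\<close>: elements of one cyclic group have the same \<open>n\<close>-th power. Otherwise the elements \<open>x\<close> of
  larger index are comparable to all elements of the clique, because \<open>x\<close> lies in no cyclic group; so
  the greatest of them has all elements of the clique among its powers.
\<close>

lemma finite_clique_subset_monogenic: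
  fixes C :: "'a::semigroup_mult set"
  assumes n: "uniform_idempotent_power TYPE('a) n"
    and C: "finite C" "C \<noteq> {}" "clique C cyclic_graph_edges"
  shows "\<exists>a. C \<subseteq> sg_gen {a}"
proof -
  note fin = finite_sg_gen[OF n]
  have n1: "n \<ge> 1" using n by (simp add: uniform_idempotent_power_def)
  have edge: "monogenic (sg_gen {x, y})" if "x \<in> C" "y \<in> C" for x y
    using C(3) that by (simp add: clique_cyclic_graph_iff)
  show ?thesis
  proof (cases "\<forall>x\<in>C. sg_index x = 1")
    case True
    have pair: "\<exists>c. sg_index c = 1 \<and> x \<in> sg_gen {c} \<and> y \<in> sg_gen {c}" if xy: "x \<in> C" "y \<in> C" for x y
      using edge[OF xy]
      by (rule monogenic_edge_cases[OF fin]) (use True xy self_mem_sg_gen in blast)+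
    obtain x0 where x0: "x0 \<in> C" using C by blast
    define e where "e = sg_power x0 n"
    have e: "e * e = e" using n by (simp add: uniform_idempotent_power_def e_def)
    have xe: "sg_power x n = e" if x: "x \<in> C" for x
    proof -
      obtain c where c: "x \<in> sg_gen {c}" "x0 \<in> sg_gen {c}" using pair[OF x x0] by blast
      have "sg_power y n = sg_power c n" if y: "y \<in> sg_gen {c}" for y
      proof -
        obtain i where i: "i \<ge> 1" "y = sg_power c i" using y by (auto simp: mem_sg_gen_singleton)
        then have "sg_power y n = sg_power (sg_power c n) i"
          using n1 by (simp add: sg_power_mult mult.commute)
        also have "\<dots> = sg_power c n"
          using n i by (intro sg_power_idem) (auto simp: uniform_idempotent_power_def)
        finally show ?thesis .
      qed
      then show ?thesis using c unfolding e_def by metis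
    qed
    have "e * x = x" if x: "x \<in> C" for x
    proof -
      have "[n + 1 = 1] (mod sg_period x)"
        using sg_period_dvd[OF n, of x] by (simp add: cong_altdef_nat)
      then have "sg_power x (n + 1) = sg_power x 1"
        using True x by (subst sg_power_eq_iff[OF fin]) auto
      then show ?thesis using xe[OF x] sg_power_add[OF n1, of 1 x] by (simp add: sg_power_1[simplified])
    qed
    then show ?thesis
      using pairwise_cyclic_imp_cyclic[OF fin e C(1,2) n1] xe pair by blast
  next
    case False
    define X where "X = {x \<in> C. sg_index x \<noteq> 1}"
    have comp: "y \<in> sg_gen {x} \<or> x \<in> sg_gen {y}" if xy: "x \<in> X" "y \<in> C" for x y
    proof -
      have "monogenic (sg_gen {x, y})" using xy by (auto simp: X_def intro: edge)
      then show ?thesis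
        by (rule monogenic_edge_cases[OF fin]) (use xy sg_index_1_mem[OF fin] in \<open>auto simp: X_def\<close>)
    qed
    have "\<exists>t\<in>X. X \<subseteq> sg_gen {t}"
    proof (rule exists_greatest_sg_gen)
      show "finite X" "X \<noteq> {}" using C False by (auto simp: X_def)
      show "x \<in> sg_gen {y} \<or> y \<in> sg_gen {x}" if "x \<in> X" "y \<in> X" for x y
        using comp[OF that(1), of y] that by (auto simp: X_def)
    qed
    then obtain t where t: "t \<in> X" "X \<subseteq> sg_gen {t}" by blast
    have "y \<in> sg_gen {t}" if y: "y \<in> C" "y \<notin> X" for y
    proof -
      have "t \<notin> sg_gen {y}" using sg_index_1_mem[OF fin, of y t] y t by (auto simp: X_def)
      then show ?thesis using comp[OF t(1) y(1)] by blast
    qed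
    then show ?thesis using t by blast
  qed
qed

lemma exists_max_generator:
  fixes x :: "'a::semigroup_mult"
  assumes n: "uniform_idempotent_power TYPE('a) n"
  shows "\<exists>a\<in>max_generators. x \<in> sg_gen {a}"
proof -
  obtain a where a: "x \<in> sg_gen {a}"
    and max: "\<And>b. x \<in> sg_gen {b} \<Longrightarrow> card (sg_gen {b}) \<le> card (sg_gen {a})"
    using ex_has_greatest_nat[of "\<lambda>a. x \<in> sg_gen {a}" x "\<lambda>a. card (sg_gen {a})" "Suc (2 * n)"]
      self_mem_sg_gen[of x] card_sg_gen_le[OF n] by (auto simp: less_Suc_eq_le)
  have "\<not> sg_gen {a} \<subset> sg_gen {b}" for b
    using max[of b] a psubset_card_mono[OF finite_sg_gen[OF n], of "sg_gen {a}" b]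
    by (meson leD psubset_imp_subset subsetD)
  then have "a \<in> max_generators"
    by (auto simp: max_generators_def maximal_monogenic_def monogenic_def)
  then show ?thesis using a by blast
qed

text \<open>
  The exponents \<open>d\<close> below the index with \<open>a\<^sup>d \<in> C\<close> form the set \<open>D\<close>, and the elements of \<open>C\<close> of
  index 1 form the set \<open>K\<close>. In the range of \<open>D\<close> distinct exponents give distinct powers, hence
  comparability of the powers becomes divisibility of the exponents, and the wanted \<open>k\<close> is the
  maximum of \<open>D\<close>. If \<open>D\<close> is empty, \<open>k = 1\<close> serves when the index exceeds 1.
\<close>

lemma card_clique_in_monogenic:
  fixes a :: "'a::semigroup_mult"
  assumes fin: "\<And>a :: 'a. finite (sg_gen {a})"
    and C: "C \<subseteq> sg_gen {a}" "clique C cyclic_graph_edges"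
  shows "(sg_index a = 1 \<and> card C \<le> sg_period a) \<or>
    (\<exists>k. 1 \<le> k \<and> k < sg_index a \<and> card C \<le> mu a k)"
proof -
  define m where "m = sg_index a"
  have edge: "monogenic (sg_gen {x, y})" if "x \<in> C" "y \<in> C" for x y
    using C(2) that by (simp add: clique_cyclic_graph_iff)
  have finC: "finite C" using C(1) fin finite_subset by blast
  define K where "K = {x \<in> C. sg_index x = 1}"
  define D where "D = {d. 1 \<le> d \<and> d < m \<and> sg_power a d \<in> C}"
  have CKD: "C \<subseteq> K \<union> sg_power a ` D"
  proof
    fix x assume x: "x \<in> C"
    then obtain i where i: "i \<ge> 1" "x = sg_power a i" using C(1) by (blast dest: mem_sg_gen_singleton[THEN iffD1])
    then show "x \<in> K \<union> sg_power a ` D"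
      using x sg_index_1_power_iff[OF fin, of i a] by (cases "m \<le> i") (auto simp: K_def D_def m_def)
  qed
  have finD: "finite D" using finite_subset[of D "{..<m}"] by (auto simp: D_def)
  have finK: "finite K" using finC by (simp add: K_def)
  have cC: "card C \<le> card K + card D"
  proof -
    have "card C \<le> card (K \<union> sg_power a ` D)" using CKD finD finK by (intro card_mono) auto
    also have "\<dots> \<le> card K + card (sg_power a ` D)" by (rule card_Un_le)
    also have "\<dots> \<le> card K + card D" using card_image_le[OF finD] by simp
    finally show ?thesis .
  qed
  have cardK: "card K \<le> sg_period a div gcd (sg_period a) k"
    if "k \<ge> 1" "K \<subseteq> sg_gen {sg_power a k}" for k
    using that card_mono[of "{x \<in> sg_gen {sg_power a k}. sg_index x = 1}" K]
      card_kernel_power[OF fin that(1), of a] fin by (auto simp: K_def)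
  have K1: "K \<subseteq> sg_gen {sg_power a 1}" using C(1) by (auto simp: K_def sg_power_1[simplified])
  have m1: "m \<ge> 1" using sg_index_ge_1[OF fin] by (simp add: m_def)
  show ?thesis
  proof (cases "D = {}")
    case True
    then have c: "card C \<le> sg_period a" using cC cardK[OF _ K1] by simp
    show ?thesis
    proof (cases "m = 1")
      case False
      then have "1 \<le> (1::nat) \<and> 1 < sg_index a \<and> card C \<le> mu a 1" using c m1 by (simp add: mu_def m_def)
      then show ?thesis by blast
    qed (use c in \<open>simp add: m_def\<close>)
  next
    case False
    have dvd: "c dvd d \<or> d dvd c" if cd: "c \<in> D" "d \<in> D" for c d
    proof -
      have mem: "i dvd j" if ij: "i \<in> D" "j \<in> D" "sg_power a j \<in> sg_gen {sg_power a i}" for i j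
      proof -
        obtain l where l: "l \<ge> 1" "sg_power a j = sg_power a (i * l)"
          using ij by (auto simp: mem_sg_gen_singleton sg_power_mult D_def)
        moreover have "i * l \<ge> 1" using l ij by (auto simp: D_def Suc_leI)
        ultimately have "j = i * l" using ij sg_power_eq_iff[OF fin, of j "i * l" a]
          by (auto simp: D_def m_def)
        then show ?thesis by simp
      qed
      have idx: "sg_index (sg_power a c) \<noteq> 1"
        using cd sg_index_1_power_iff[OF fin, of c a] by (auto simp: D_def m_def)
      have "monogenic (sg_gen {sg_power a c, sg_power a d})" using cd by (intro edge) (auto simp: D_def)
      then show ?thesis
        by (rule monogenic_edge_cases[OF fin])
          (use mem[of c d] mem[of d c] cd idx sg_index_1_mem[OF fin] in auto)
    qed
    define k where "k = Max D"
    have kD: "k \<in> D" using False finD by (simp add: k_def)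
    then have k: "1 \<le> k" "k < m" by (auto simp: D_def)
    have "d dvd k" if "d \<in> D" for d
    proof -
      have "d \<le> k" using that finD by (simp add: k_def)
      moreover have "d \<ge> 1" using that by (simp add: D_def)
      ultimately show ?thesis using dvd[OF that kD] dvd_imp_le[of k d] by auto
    qed
    then have "card D \<le> 1 + num_prime_factors k" using dvd k by (intro card_divisor_chain_le) auto
    moreover have "K \<subseteq> sg_gen {sg_power a k}"
    proof
      fix x assume x: "x \<in> K"
      have idx: "sg_index (sg_power a k) \<noteq> 1"
        using k sg_index_1_power_iff[OF fin, of k a] by (auto simp: m_def)
      have "monogenic (sg_gen {sg_power a k, x})"
        using kD x by (intro edge) (auto simp: D_def K_def)
      then show "x \<in> sg_gen {sg_power a k}"
        by (rule monogenic_edge_cases[OF fin])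
          (use x idx sg_index_1_mem[OF fin] in \<open>auto simp: K_def\<close>)
    qed
    ultimately have "card C \<le> mu a k" using cC cardK[OF k(1)] by (simp add: mu_eq)
    then show ?thesis using k by (auto simp: m_def)
  qed
qed

text \<open>
  The elements of index 1 among the powers of \<open>b = a\<^sup>k\<close> form a group, generated by any \<open>b\<^sup>l\<close> with \<open>l\<close> at
  least the index and congruent to 1 modulo the period.
\<close>

lemma kernel_clique:
  assumes "finite (sg_gen {a})" "k \<ge> 1"
    "x \<in> sg_gen {sg_power a k}" "sg_index x = 1" "y \<in> sg_gen {sg_power a k}" "sg_index y = 1"
  shows "monogenic (sg_gen {x, y})"
proof -
  define b where "b = sg_power a k"
  have fin: "finite (sg_gen {b})" unfolding b_def using assms finite_sg_gen_power sg_power_mem by blast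
  define m r where "m = sg_index b" and "r = sg_period b"
  have m: "m \<ge> 1" and r: "r \<ge> 1" using sg_index_ge_1[OF fin] sg_period_ge_1[OF fin]
    by (simp_all add: m_def r_def)
  define c where "c = sg_power b (m * r + 1)"
  have "m \<le> m * r + 1" using r by (cases r) auto
  then have c1: "sg_index c = 1"
    unfolding c_def m_def by (subst sg_index_1_power_iff[OF fin]) auto
  have mem: "z \<in> sg_gen {c}" if z: "z \<in> sg_gen {b}" "sg_index z = 1" for z
  proof -
    obtain i where i: "i \<ge> 1" "z = sg_power b i" using z by (auto simp: mem_sg_gen_singleton)
    then have "m \<le> i" using z sg_index_1_power_iff[OF fin, of i] by (simp add: m_def)
    moreover have "m \<le> (m * r + 1) * i" using \<open>m \<le> m * r + 1\<close> i by (metis le_trans mult_le_mono2 mult.right_neutral)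
    moreover have "[i = (m * r + 1) * i] (mod r)"
    proof -
      have "(m * r + 1) * i = i + r * (m * i)" by (simp add: algebra_simps)
      then show ?thesis unfolding cong_def by (metis mod_mult_self2)
    qed
    ultimately have "sg_power b i = sg_power b ((m * r + 1) * i)"
      using i by (subst sg_power_eq_iff[OF fin]) (auto simp: m_def r_def)
    then have "z = sg_power c i" using i by (simp add: c_def sg_power_mult)
    then show ?thesis using i by (metis sg_power_mem)
  qed
  have "finite (sg_gen {c})" unfolding c_def using fin finite_sg_gen_power sg_power_mem by (metis le_add2)
  then show ?thesis
    using c1 mem assms(3-) by (intro monogenic_of_cyclic[of c]) (simp_all add: b_def)
qed

lemma exists_clique_card_period:
  fixes a :: "'a::semigroup_mult"
  assumes fin: "finite (sg_gen {a})" and a: "sg_index a = 1"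
  shows "\<exists>C :: 'a set. finite C \<and> clique C cyclic_graph_edges \<and> card C = sg_period a"
proof -
  have "{x \<in> sg_gen {sg_power a 1}. sg_index x = 1} = sg_gen {a}"
    using sg_index_1_mem[OF fin a] by (auto simp: sg_power_1[simplified])
  then have "card (sg_gen {a}) = sg_period a" using card_kernel_power[OF fin, of 1] by simp
  moreover have "clique (sg_gen {a}) cyclic_graph_edges"
    unfolding clique_cyclic_graph_iff using monogenic_of_cyclic[OF fin a] by blast
  ultimately show ?thesis using fin by blast
qed

text \<open>
  The clique consists of the \<open>a\<^sup>d\<close> for \<open>d\<close> in a longest chain of divisors of \<open>k\<close> and of all elements
  of index 1 in the subsemigroup generated by \<open>a\<^sup>k\<close>. The latter are powers of every \<open>a\<^sup>d\<close>, since \<open>d\<close>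
  divides \<open>k\<close>.
\<close>

lemma exists_clique_card_mu:
  fixes a :: "'a::semigroup_mult"
  assumes fin: "finite (sg_gen {a})" and k: "1 \<le> k" "k < sg_index a"
  shows "\<exists>C :: 'a set. finite C \<and> clique C cyclic_graph_edges \<and> card C = mu a k"
proof -
  obtain D where D: "finite D" "card D = 1 + num_prime_factors k" "\<forall>d\<in>D. d dvd k"
    "\<forall>c\<in>D. \<forall>d\<in>D. c dvd d \<or> d dvd c" using exists_divisor_chain[OF k(1)] by blast
  have d1: "1 \<le> d \<and> d < sg_index a" if "d \<in> D" for d
    using D(3) that k dvd_imp_le[of d k] dvd_pos_nat[of k d] by (auto simp: Suc_leI)
  define K where "K = {x \<in> sg_gen {sg_power a k}. sg_index x = 1}"
  have finK: "finite K"
    using finite_sg_gen_power[OF fin sg_power_mem[OF k(1)]] by (simp add: K_def)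
  have mem: "sg_power a d \<in> sg_gen {sg_power a c}" if "c dvd d" "1 \<le> c" "1 \<le> d" for c d
  proof -
    from that(1) obtain q where q: "d = c * q" by blast
    then have "q \<ge> 1" using that by (cases q) auto
    then have "sg_power a d = sg_power (sg_power a c) q" using q that by (simp add: sg_power_mult)
    then show ?thesis using sg_power_mem[OF \<open>q \<ge> 1\<close>] by metis
  qed
  have memK: "x \<in> sg_gen {sg_power a d}" if "x \<in> K" "d \<in> D" for x d
  proof -
    have "sg_power a k \<in> sg_gen {sg_power a d}" using mem[of d k] D(3) d1 that k by blast
    then show ?thesis using that sg_gen_least[of "{sg_power a k}"] by (auto simp: K_def)
  qed
  define C where "C = sg_power a ` D \<union> K"
  have "monogenic (sg_gen {x, y})" if xy: "x \<in> C" "y \<in> C" for x y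
  proof -
    have sym: "sg_gen {x, y} = sg_gen {y, x}" by (simp add: insert_commute)
    consider c d where "c \<in> D" "d \<in> D" "x = sg_power a c" "y = sg_power a d"
      | d where "d \<in> D" "x = sg_power a d" "y \<in> K" | d where "d \<in> D" "y = sg_power a d" "x \<in> K"
      | "x \<in> K" "y \<in> K" using xy by (auto simp: C_def)
    then show ?thesis
    proof cases
      case 1
      then have "x \<in> sg_gen {y} \<or> y \<in> sg_gen {x}"
        using D(4) mem[of c d] mem[of d c] d1 by blast
      then show ?thesis using monogenic_comparable[of x y] monogenic_comparable[of y x] sym by metis
    next
      case 2
      then show ?thesis using memK monogenic_comparable[of y x] sym by metis
    next
      case 3
      then show ?thesis using memK monogenic_comparable[of x y] by metis
    next
      case 4
      then show ?thesis using kernel_clique[OF fin k(1)] by (simp add: K_def)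
    qed
  qed
  then have "clique C cyclic_graph_edges" by (simp add: clique_cyclic_graph_iff)
  moreover have "card C = mu a k"
  proof -
    have "inj_on (sg_power a) D"
    proof (rule inj_onI)
      fix c d assume "c \<in> D" "d \<in> D" "sg_power a c = sg_power a d"
      then show "c = d" using d1[of c] d1[of d] sg_power_eq_iff[OF fin, of c d] by auto
    qed
    moreover have "sg_power a ` D \<inter> K = {}"
      using d1 sg_index_1_power_iff[OF fin] by (force simp: K_def)
    ultimately have "card C = card D + card K"
      unfolding C_def using D(1) finK by (subst card_Un_disjoint) (auto simp: card_image)
    then show ?thesis using D(2) card_kernel_power[OF fin k(1)] by (simp add: K_def mu_eq)
  qed
  moreover have "finite C" using D(1) finK by (simp add: C_def)
  ultimately show ?thesis by blast
qed

theorem theorem4p10: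
  fixes n :: nat
  assumes "bounded_exponent TYPE('a::semigroup_mult)"
    and "exponent TYPE('a) = n"
  defines "R \<equiv> {sg_period a | a::'a. sg_index a = 1 \<and> a \<in> max_generators}
             \<union> {mu a k | (a::'a) k. sg_index a > 1 \<and> 1 \<le> k \<and> k < sg_index a \<and> a \<in> max_generators}"
  shows "finite R \<and> R \<noteq> {} \<and>
         clique_number (UNIV :: 'a set) cyclic_graph_edges = enat (Max R)"
proof -
  have n: "uniform_idempotent_power TYPE('a) n"
    using assms(1,2) unfolding bounded_exponent_def exponent_def by (metis LeastI)
  then have "n \<ge> 1" by (simp add: uniform_idempotent_power_def)
  note fin = finite_sg_gen[OF n]
  have period: "sg_period a \<le> n" for a :: 'a
    using sg_period_dvd[OF n, of a] \<open>n \<ge> 1\<close> by (simp add: dvd_imp_le)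
  have "R \<subseteq> {..n} \<union> (\<lambda>(r, k). 1 + num_prime_factors k + r div gcd r k) ` ({..n} \<times> {..n})"
  proof
    fix s assume "s \<in> R"
    then consider a :: 'a where "s = sg_period a" | a :: 'a and k where "s = mu a k" "k < sg_index a"
      unfolding R_def by blast
    then show "s \<in> {..n} \<union> (\<lambda>(r, k). 1 + num_prime_factors k + r div gcd r k) ` ({..n} \<times> {..n})"
    proof cases
      case 1
      then show ?thesis using period by simp
    next
      case 2
      then have "(sg_period a, k) \<in> {..n} \<times> {..n}" using period[of a] sg_index_le[OF n, of a] by simp
      then show ?thesis using 2(1) by (force simp: mu_eq)
    qed
  qed
  then have finR: "finite R" by (rule finite_subset) simp
  have bound: "\<exists>s\<in>R. card C \<le> s" if C: "finite C" "C \<noteq> {}" "clique C cyclic_graph_edges" for C :: "'a set"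
  proof -
    obtain b where b: "C \<subseteq> sg_gen {b}" using finite_clique_subset_monogenic[OF n C] by blast
    obtain a where a: "a \<in> max_generators" "b \<in> sg_gen {a}" using exists_max_generator[OF n] by blast
    then have Ca: "C \<subseteq> sg_gen {a}" using b sg_gen_least[of "{b}" "{a}"] by auto
    show ?thesis using card_clique_in_monogenic[OF fin Ca C(3)]
    proof (elim disjE exE)
      assume "sg_index a = 1 \<and> card C \<le> sg_period a"
      then show ?thesis using a(1) unfolding R_def by blast
    next
      fix k assume "1 \<le> k \<and> k < sg_index a \<and> card C \<le> mu a k"
      moreover from this have "sg_index a > 1" by simp
      ultimately show ?thesis using a(1) unfolding R_def by blast
    qed
  qed
  have neR: "R \<noteq> {}"
    using bound[of "{undefined}"] by (auto simp: clique_def)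
  have "clique_number (UNIV :: 'a set) cyclic_graph_edges \<le> enat (Max R)"
    unfolding clique_number_def
  proof (rule SUP_least)
    fix C :: "'a set" assume "C \<in> {C. C \<subseteq> UNIV \<and> finite C \<and> clique C cyclic_graph_edges}"
    then have C: "finite C" "clique C cyclic_graph_edges" by auto
    show "enat (card C) \<le> enat (Max R)"
    proof (cases "C = {}")
      case False
      then obtain s where "s \<in> R" "card C \<le> s" using bound C by blast
      then show ?thesis using Max_ge[OF finR, of s] by simp
    qed simp
  qed
  moreover have "enat (Max R) \<le> clique_number (UNIV :: 'a set) cyclic_graph_edges"
  proof -
    have "Max R \<in> R" using finR neR by simp
    then have "\<exists>C :: 'a set. finite C \<and> clique C cyclic_graph_edges \<and> card C = Max R"
      unfolding R_def using exists_clique_card_period[OF fin] exists_clique_card_mu[OF fin] by auto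
    then obtain C :: "'a set" where C: "finite C" "clique C cyclic_graph_edges" "card C = Max R" by blast
    then have "enat (card C) \<le> clique_number (UNIV :: 'a set) cyclic_graph_edges"
      unfolding clique_number_def by (intro SUP_upper) auto
    then show ?thesis using C by simp
  qed
  ultimately show ?thesis using finR neR by simp
qed

end
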